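(* Let $n\ge 1$, let $\mathcal{L} \subset \mathbb{R}^{2n}$ be a Lagrangian subspace and $\mathbf{B} = (x_1, \ldots , x_n)$ any ordered basis of $\mathcal{L}$. Let $X_L = [\,x_1 \; x_2 \; \cdots \; x_{n-1}\,]$ and $X_R = [\,x_2 \; x_3 \; \cdots \; x_n\,]$ (both in $\mathbb{R}^{2n \times (n-1)}$), and consider the matrix $$\widehat{H} := X_RX_L^+ + J_{2n}^T(X_RX_L^+)^TJ_{2n} \in \mathbb{R}^{2n \times 2n}.$$ Then $\widehat{H} \in \mathbb{HK}(\mathbf{B})$.
   Context: $J_{2n} = \begin{bmatrix} 0 & I_n \\ -I_n & 0 \end{bmatrix} \in \mathbb{R}^{2n\times 2n}$. A subspace $\mathcal{L}\subset\mathbb{R}^{2n}$ is called isotropic if $x^TJ_{2n}y = 0$ for all $x,y\in\mathcal{L}$, and Lagrangian if it is isotropic and of dimension $n$. A matrix $H\in\mathbb{R}^{2n\times 2n}$ is called skew-Hamiltonian if $J_{2n}^TH^TJ_{2n} = H$. For an ordered basis $\mathbf{B}=(x_1,\ldots,x_n)$ of a Lagrangian subspace, $\mathbb{HK}(\mathbf{B})=\mathbb{HK}(x_1,\ldots,x_n)$ denotes the set of all skew-Hamiltonian matrices $H\in\mathbb{R}^{2n\times 2n}$ satisfying $Hx_k = x_{k+1}$ for all $k=1,\ldots,n-1$. $A^+$ denotes the Moore-Penrose pseudoinverse of $A$. (For $n=1$ the matrices $X_L,X_R$ have no columns and $X_RX_L^+$ is the zero matrix.) *)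

theory Defs
  imports "Jordan_Normal_Form.VS_Connect"
begin

abbreviation R_space :: "nat \<Rightarrow> (real, real vec) module" where
  "R_space m \<equiv> module_vec TYPE(real) m"

abbreviation subsp :: "nat \<Rightarrow> real vec set \<Rightarrow> (real, real vec) module" where
  "subsp m L \<equiv> (R_space m)\<lparr>carrier := L\<rparr>"

definition J_mat :: "nat \<Rightarrow> real mat" where
  "J_mat n = four_block_mat (0\<^sub>m n n) (1\<^sub>m n) (- 1\<^sub>m n) (0\<^sub>m n n)"

definition isotropic :: "nat \<Rightarrow> real vec set \<Rightarrow> bool" where
  "isotropic n L \<longleftrightarrow> VectorSpace.subspace class_ring L (R_space (2 * n)) \<and>
     (\<forall>x\<in>L. \<forall>y\<in>L. x \<bullet> (J_mat n *\<^sub>v y) = 0)"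

definition lagrangian :: "nat \<Rightarrow> real vec set \<Rightarrow> bool" where
  "lagrangian n L \<longleftrightarrow> isotropic n L \<and> vectorspace.dim class_ring (subsp (2 * n) L) = n"

definition ordered_basis :: "nat \<Rightarrow> real vec set \<Rightarrow> real vec list \<Rightarrow> bool" where
  "ordered_basis m L xs \<longleftrightarrow>
     distinct xs \<and> vectorspace.basis class_ring (subsp m L) (set xs)"

definition skew_hamiltonian :: "nat \<Rightarrow> real mat \<Rightarrow> bool" where
  "skew_hamiltonian n H \<longleftrightarrow>
     H \<in> carrier_mat (2 * n) (2 * n) \<and> (J_mat n)\<^sup>T * H\<^sup>T * J_mat n = H"

text \<open>The list \<open>xs\<close> stands for $(x_1,\ldots,x_n)$, so \<open>xs ! k\<close> is $x_{k+1}$.\<close>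

definition HK :: "nat \<Rightarrow> real vec list \<Rightarrow> real mat set" where
  "HK n xs = {H. skew_hamiltonian n H \<and> (\<forall>k < n - 1. H *\<^sub>v (xs ! k) = xs ! Suc k)}"

text \<open>The four Penrose conditions; over the reals the conjugate transpose is the transpose.\<close>

definition is_pinv :: "real mat \<Rightarrow> real mat \<Rightarrow> bool" where
  "is_pinv A P \<longleftrightarrow> P \<in> carrier_mat (dim_col A) (dim_row A) \<and>
     A * P * A = A \<and> P * A * P = P \<and> (A * P)\<^sup>T = A * P \<and> (P * A)\<^sup>T = P * A"

lemma is_pinv_unique:
  assumes "is_pinv A P" and "is_pinv A Q"
  shows "P = Q"
proof -
  define m n where "m = dim_row A" and "n = dim_col A"
  have A: "A \<in> carrier_mat m n" and P: "P \<in> carrier_mat n m" and Q: "Q \<in> carrier_mat n m"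
    using assms by (auto simp: is_pinv_def m_def n_def)
  have p: "A * P * A = A" "P * A * P = P" "(A * P)\<^sup>T = A * P" "(P * A)\<^sup>T = P * A"
    and q: "A * Q * A = A" "Q * A * Q = Q" "(A * Q)\<^sup>T = A * Q" "(Q * A)\<^sup>T = Q * A"
    using assms by (auto simp: is_pinv_def)
  have AP: "A * P \<in> carrier_mat m m" and AQ: "A * Q \<in> carrier_mat m m"
    and PA: "P * A \<in> carrier_mat n n" and QA: "Q * A \<in> carrier_mat n n"
    using A P Q by auto
  have "A * P = (A * Q) * (A * P)"
    using q(1) assoc_mult_mat[OF AQ A P] by simp
  also have "\<dots> = ((A * P) * (A * Q))\<^sup>T"
    using transpose_mult[OF AP AQ] p(3) q(3) by simp
  also have "(A * P) * (A * Q) = A * Q"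
    using p(1) assoc_mult_mat[OF AP A Q] by simp
  finally have 1: "A * P = A * Q" using q(3) by simp
  have "P * A = (P * A) * (Q * A)"
    using q(1) assoc_mult_mat[OF P A QA] assoc_mult_mat[OF A Q A] by simp
  also have "\<dots> = ((Q * A) * (P * A))\<^sup>T"
    using transpose_mult[OF QA PA] p(4) q(4) by simp
  also have "(Q * A) * (P * A) = Q * A"
    using p(1) assoc_mult_mat[OF Q A PA] assoc_mult_mat[OF A P A] by simp
  finally have 2: "P * A = Q * A" using q(4) by simp
  have "P = P * (A * P)" using p(2) assoc_mult_mat[OF P A P] by simp
  also have "\<dots> = P * A * Q" using 1 assoc_mult_mat[OF P A Q] by simp
  also have "\<dots> = Q" using 2 q(2) by simp
  finally show ?thesis .
qed

definition pinv :: "real mat \<Rightarrow> real mat" where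
  "pinv A = (THE P. is_pinv A P)"

lemma pinv_eqI: "is_pinv A P \<Longrightarrow> pinv A = P"
  unfolding pinv_def using is_pinv_unique by blast

text \<open>For \<open>n = 1\<close> both matrices have no columns, and \<open>X_R * pinv X_L\<close> is the
  zero matrix as an empty sum.\<close>

definition X_L :: "nat \<Rightarrow> real vec list \<Rightarrow> real mat" where
  "X_L n xs = mat_of_cols (2 * n) (butlast xs)"

definition X_R :: "nat \<Rightarrow> real vec list \<Rightarrow> real mat" where
  "X_R n xs = mat_of_cols (2 * n) (tl xs)"

definition H_hat :: "nat \<Rightarrow> real vec list \<Rightarrow> real mat" where
  "H_hat n xs = X_R n xs * pinv (X_L n xs) +
     (J_mat n)\<^sup>T * (X_R n xs * pinv (X_L n xs))\<^sup>T * J_mat n"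

end

theory Submission
  imports Defs "Jordan_Normal_Form.DL_Rank"
begin

text \<open>Write \<open>M = X\<^sub>R X\<^sub>L\<^sup>+\<close>. The columns of \<open>X\<^sub>L\<close> are linearly independent, so
  \<open>X\<^sub>L\<^sup>+ X\<^sub>L = 1\<close> and hence \<open>M x\<^sub>k = x\<^sub>k\<^sub>+\<^sub>1\<close>. The second summand \<open>J\<^sup>T M\<^sup>T J\<close> contains the factor
  \<open>X\<^sub>R\<^sup>T J\<close>, which annihilates every vector of the isotropic space spanned by \<open>B\<close>. It makes the
  sum skew-Hamiltonian because \<open>A \<mapsto> J\<^sup>T A\<^sup>T J\<close> is an involution.\<close>

lemma J_mat_carrier [simp]: "J_mat n \<in> carrier_mat (2 * n) (2 * n)"
  by (auto simp: J_mat_def)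

lemma dim_J_mat [simp]: "dim_row (J_mat n) = 2 * n" "dim_col (J_mat n) = 2 * n"
  using J_mat_carrier[of n] by blast+

lemma J_mat_square: "J_mat n * J_mat n = - 1\<^sub>m (2 * n)"
proof -
  have "J_mat n * J_mat n = four_block_mat (- 1\<^sub>m n) (0\<^sub>m n n) (0\<^sub>m n n) (- 1\<^sub>m n)"
    unfolding J_mat_def
    by (subst mult_four_block_mat[of _ n n _ n _ n _ _ n _ n]) auto
  also have "\<dots> = - 1\<^sub>m (2 * n)"
    by (rule eq_matI) auto
  finally show ?thesis .
qed

lemma transpose_J_mat: "(J_mat n)\<^sup>T = - J_mat n"
  unfolding J_mat_def
  by (subst transpose_four_block_mat[of _ n n _ n _ n]) (auto intro!: eq_matI)

text \<open>Since \<open>J\<^sup>T = - J\<close>, resolving the transposes regroups the product as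
  \<open>(J * J) * (M * (J * J))\<close>. Both squares are minus the identity, so the signs
  cancel.\<close>

lemma J_adjoint_involution:
  assumes M: "M \<in> carrier_mat (2 * n) (2 * n)"
  shows "(J_mat n)\<^sup>T * ((J_mat n)\<^sup>T * M\<^sup>T * J_mat n)\<^sup>T * J_mat n = M"
proof -
  let ?J = "J_mat n"
  note J = J_mat_carrier[of n]
  have JT: "?J\<^sup>T \<in> carrier_mat (2 * n) (2 * n)" using J by simp
  have "?J\<^sup>T * M\<^sup>T \<in> carrier_mat (2 * n) (2 * n)" using M by auto
  then have "(?J\<^sup>T * M\<^sup>T * ?J)\<^sup>T = ?J\<^sup>T * (M * ?J)"
    using transpose_mult[OF _ J] transpose_mult[OF JT, of "M\<^sup>T" "2 * n"] M by simp
  then have "?J\<^sup>T * (?J\<^sup>T * M\<^sup>T * ?J)\<^sup>T * ?J = ?J * (?J * (M * ?J)) * ?J"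
    using M unfolding transpose_J_mat by simp
  also have "\<dots> = (?J * ?J) * (M * (?J * ?J))"
    by (simp only: assoc_mult_mat[OF J J mult_carrier_mat[OF M J], symmetric]
        assoc_mult_mat[OF mult_carrier_mat[OF J J] mult_carrier_mat[OF M J] J]
        assoc_mult_mat[OF M J J])
  also have "\<dots> = M"
    using M by (simp add: J_mat_square)
  finally show ?thesis .
qed

text \<open>The map sending \<open>A\<close> to \<open>J\<^sup>T * A\<^sup>T * J\<close> is additive
  and an involution, so it swaps the two summands and fixes their sum.\<close>

lemma skew_hamiltonian_symmetrization:
  assumes M: "M \<in> carrier_mat (2 * n) (2 * n)"
  shows "skew_hamiltonian n (M + (J_mat n)\<^sup>T * M\<^sup>T * J_mat n)"
proof -
  let ?J = "J_mat n"
  define N where "N = ?J\<^sup>T * M\<^sup>T * ?J"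
  note J = J_mat_carrier[of n]
  have N: "N \<in> carrier_mat (2 * n) (2 * n)"
    using M J unfolding N_def by auto
  have JT: "?J\<^sup>T \<in> carrier_mat (2 * n) (2 * n)"
    and MT: "M\<^sup>T \<in> carrier_mat (2 * n) (2 * n)" and NT: "N\<^sup>T \<in> carrier_mat (2 * n) (2 * n)"
    using M N by simp_all
  have "?J\<^sup>T * (M + N)\<^sup>T * ?J = ?J\<^sup>T * M\<^sup>T * ?J + ?J\<^sup>T * N\<^sup>T * ?J"
    by (simp only: transpose_add[OF M N] mult_add_distrib_mat[OF JT MT NT]
        add_mult_distrib_mat[OF mult_carrier_mat[OF JT MT] mult_carrier_mat[OF JT NT] J])
  also have "?J\<^sup>T * M\<^sup>T * ?J = N" by (simp add: N_def)
  also have "?J\<^sup>T * N\<^sup>T * ?J = M"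
    unfolding N_def by (rule J_adjoint_involution[OF M])
  also have "N + M = M + N" using M N by (rule comm_add_mat[rotated])
  finally show ?thesis
    using M N unfolding skew_hamiltonian_def N_def[symmetric] by simp
qed

lemma mult_mat_zero_vec:
  "A \<in> carrier_mat m k \<Longrightarrow> A *\<^sub>v 0\<^sub>v k = 0\<^sub>v m"
  by auto

text \<open>Pairing the hypothesis with \<open>v\<close> gives the squared norm of
  \<open>A *\<^sub>v v\<close>, and the real scalar product is definite.\<close>

lemma gram_matrix_kernel:
  fixes A :: "real mat"
  assumes A: "A \<in> carrier_mat m k" and v: "v \<in> carrier_vec k"
    and 0: "(A\<^sup>T * A) *\<^sub>v v = 0\<^sub>v k"
  shows "A *\<^sub>v v = 0\<^sub>v m"
proof -
  have Av: "A *\<^sub>v v \<in> carrier_vec m" using A v by simp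
  have "(A *\<^sub>v v) \<bullet> (A *\<^sub>v v) = v \<bullet> (A\<^sup>T *\<^sub>v (A *\<^sub>v v))"
    using transpose_vec_mult_scalar[OF A v Av] A v Av
    by (metis comm_scalar_prod mult_mat_vec_carrier transpose_carrier_mat)
  also have "A\<^sup>T *\<^sub>v (A *\<^sub>v v) = 0\<^sub>v k"
    using 0 A v by (simp add: assoc_mult_mat_vec[of _ k m _ k])
  \<comment> \<open>Definiteness is applied in its conjugate form \<open>\<bullet>c\<close>; over
    the reals conjugation is the identity.\<close>
  finally have "(A *\<^sub>v v) \<bullet>c (A *\<^sub>v v) = 0"
    using v by simp
  then show ?thesis using conjugate_square_eq_0_vec[OF Av] by blast
qed

text \<open>Full column rank makes the Gram matrix \<open>A\<^sup>T * A\<close> invertible. With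
  \<open>B\<close> its inverse, \<open>B * A\<^sup>T\<close> is a left inverse of \<open>A\<close>
  and satisfies the Penrose conditions.\<close>

lemma pinv_injective:
  fixes A :: "real mat"
  assumes A: "A \<in> carrier_mat m k"
    and inj: "\<And>v. v \<in> carrier_vec k \<Longrightarrow> A *\<^sub>v v = 0\<^sub>v m \<Longrightarrow> v = 0\<^sub>v k"
  shows "pinv A \<in> carrier_mat k m" and "pinv A * A = 1\<^sub>m k"
proof -
  let ?G = "A\<^sup>T * A"
  have AT: "A\<^sup>T \<in> carrier_mat k m" and G: "?G \<in> carrier_mat k k" using A by auto
  have "det ?G \<noteq> 0"
    using gram_matrix_kernel[OF A] inj det_0_iff_vec_prod_zero_field[OF G] by blast
  then obtain B where B: "B \<in> carrier_mat k k" and BG: "B * ?G = 1\<^sub>m k" and GB: "?G * B = 1\<^sub>m k"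
    using det_non_zero_imp_unit[OF G, where b = "()"] unfolding Units_def by (auto simp: ring_mat_def)
  \<comment> \<open>The inverse of the symmetric \<open>?G\<close> is symmetric. This is what the
    Penrose condition on \<open>(A * ?P)\<^sup>T\<close> requires.\<close>
  have "B\<^sup>T * ?G = 1\<^sub>m k"
    using GB transpose_mult[OF G B] A by (simp add: transpose_mult[OF AT A])
  then have BT: "B\<^sup>T = B"
    using B G GB by (metis assoc_mult_mat left_mult_one_mat right_mult_one_mat transpose_carrier_mat)
  let ?P = "B * A\<^sup>T"
  have P: "?P \<in> carrier_mat k m" using A B by auto
  have PA: "?P * A = 1\<^sub>m k" using BG assoc_mult_mat[OF B AT A] by simp
  have "is_pinv A ?P"
    unfolding is_pinv_def
  proof (intro conjI)
    show "A * ?P * A = A"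
      using assoc_mult_mat[OF A P A] PA A by simp
    show "?P * A * ?P = ?P" unfolding PA by (rule left_mult_one_mat[OF P])
    show "(A * ?P)\<^sup>T = A * ?P"
      using transpose_mult[OF A P] transpose_mult[OF B AT] BT assoc_mult_mat[OF A B AT] by simp
    show "(?P * A)\<^sup>T = ?P * A" using PA by simp
  qed (use A P in auto)
  then have "pinv A = ?P" by (rule pinv_eqI)
  then show "pinv A \<in> carrier_mat k m" "pinv A * A = 1\<^sub>m k"
    using P PA by simp_all
qed

text \<open>A basis is defined inside the module with carrier \<open>L\<close>. Linear independence
  carries over to the ambient space, where the matrix arguments take place.\<close>

lemma ordered_basis_lin_indpt:
  assumes "VectorSpace.subspace class_ring L (R_space m)" and "ordered_basis m L xs"
  shows "set xs \<subseteq> L" and "\<not> module.lin_dep class_ring (R_space m) (set xs)"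
proof -
  interpret V: vec_space "TYPE(real)" m .
  interpret W: vectorspace class_ring "subsp m L"
    by (rule V.subspace_is_vs[OF assms(1)])
  have "W.basis (set xs)" using assms(2) by (simp add: ordered_basis_def)
  then have *: "W.lin_indpt (set xs)" and L: "set xs \<subseteq> L"
    unfolding W.basis_def by auto
  have "submodule class_ring L V.V" using assms(1) by (simp add: subspace_def)
  from V.span_li_not_depend(2)[OF L this] *
  show "V.lin_indpt (set xs)" by simp
  show "set xs \<subseteq> L" by (rule L)
qed

text \<open>A nonzero kernel vector lists the coefficients of a nontrivial relation among the
  columns. Dependence concerns the set of columns, so they have to be distinct for the entries to
  become coefficients.\<close>

lemma mat_of_cols_injective:
  fixes ys :: "real vec list"
  assumes "set ys \<subseteq> carrier_vec m" and "distinct ys"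
    and "\<not> module.lin_dep class_ring (R_space m) (set ys)"
    and "v \<in> carrier_vec (length ys)" and "mat_of_cols m ys *\<^sub>v v = 0\<^sub>v m"
  shows "v = 0\<^sub>v (length ys)"
proof (rule ccontr)
  assume "v \<noteq> 0\<^sub>v (length ys)"
  from vec_space.lin_depI[OF mat_of_cols_carrier(1) assms(4) this assms(5)] assms(1-3)
  show False by (simp add: cols_mat_of_cols)
qed

theorem theorem1:
  fixes n :: nat and L :: "real vec set" and xs :: "real vec list"
  assumes "n \<ge> 1"
    and "lagrangian n L"
    and "ordered_basis (2 * n) L xs" and "length xs = n"
  shows "H_hat n xs \<in> HK n xs"
proof -
  let ?J = "J_mat n" and ?A = "X_L n xs" and ?B = "X_R n xs"
  define M where "M = ?B * pinv ?A"
  note J = J_mat_carrier[of n]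
  interpret V: vec_space "TYPE(real)" "2 * n" .
  have sub: "VectorSpace.subspace class_ring L (R_space (2 * n))"
    and iso: "\<And>x y. x \<in> L \<Longrightarrow> y \<in> L \<Longrightarrow> x \<bullet> (?J *\<^sub>v y) = 0"
    using assms(2) by (auto simp: lagrangian_def isotropic_def)
  note xsL = ordered_basis_lin_indpt(1)[OF sub assms(3)]
    and indpt = ordered_basis_lin_indpt(2)[OF sub assms(3)]
  have "L \<subseteq> carrier_vec (2 * n)"
    using sub by (auto simp: subspace_def submodule_def module_vec_simps)
  then have xs: "set xs \<subseteq> carrier_vec (2 * n)" using xsL by blast
  have dist: "distinct xs" using assms(3) by (simp add: ordered_basis_def)
  have bl: "set (butlast xs) \<subseteq> set xs" by (auto dest: in_set_butlastD)
  have len: "length (butlast xs) = n - 1" "length (tl xs) = n - 1" using assms(4) by simp_all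
  \<comment> \<open>For \<open>n = 1\<close> these matrices have no columns; the argument covers
    this case without a split.\<close>
  have A: "?A \<in> carrier_mat (2 * n) (n - 1)" and B: "?B \<in> carrier_mat (2 * n) (n - 1)"
    using len by (auto simp: X_L_def X_R_def)
  have inj: "v = 0\<^sub>v (n - 1)" if "v \<in> carrier_vec (n - 1)" "?A *\<^sub>v v = 0\<^sub>v (2 * n)" for v
    using mat_of_cols_injective[of "butlast xs" "2 * n" v] that xs bl dist
      V.subset_li_is_li[OF indpt bl] len
    by (auto simp: X_L_def distinct_butlast)
  note P = pinv_injective(1)[OF A inj] and PA = pinv_injective(2)[OF A inj]
  have JT: "?J\<^sup>T \<in> carrier_mat (2 * n) (2 * n)"
    and PT: "(pinv ?A)\<^sup>T \<in> carrier_mat (2 * n) (n - 1)"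
    and BT: "?B\<^sup>T \<in> carrier_mat (n - 1) (2 * n)"
    using P B by simp_all
  have M: "M \<in> carrier_mat (2 * n) (2 * n)" using B P by (auto simp: M_def)
  define N where "N = ?J\<^sup>T * M\<^sup>T * ?J"
  have N: "N \<in> carrier_mat (2 * n) (2 * n)" using M J by (auto simp: N_def)
  have "M * ?A = ?B"
    unfolding M_def using assoc_mult_mat[OF B P A] PA B by simp
  moreover have "col ?A k = xs ! k" "col ?B k = xs ! Suc k" if "k < n - 1" for k
    using that len assms(4) xs
      col_mat_of_cols[of k "butlast xs" "2 * n"] col_mat_of_cols[of k "tl xs" "2 * n"]
    by (auto simp: X_L_def X_R_def nth_butlast nth_tl subset_iff)
  \<comment> \<open>Compare column \<open>k\<close> on both sides of
    \<open>M * ?A = ?B\<close>.\<close>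
  ultimately have Mx: "M *\<^sub>v (xs ! k) = xs ! Suc k" if "k < n - 1" for k
    using that col_mult2[OF M A that] by simp
  have Nx: "N *\<^sub>v x = 0\<^sub>v (2 * n)" if "x \<in> L" for x
  proof -
    have x: "x \<in> carrier_vec (2 * n)" using that \<open>L \<subseteq> _\<close> by blast
    have Jx: "?J *\<^sub>v x \<in> carrier_vec (2 * n)" by (rule mult_mat_vec_carrier[OF J x])
    \<comment> \<open>Entry \<open>i\<close> is the scalar product of \<open>xs ! Suc i\<close> with
      \<open>?J *\<^sub>v x\<close>. Both \<open>xs ! Suc i\<close> and \<open>x\<close> lie in
      \<open>L\<close>, so isotropy makes it zero.\<close>
    have 0: "?B\<^sup>T *\<^sub>v (?J *\<^sub>v x) = 0\<^sub>v (n - 1)"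
    proof (rule eq_vecI)
      fix i assume "i < dim_vec (0\<^sub>v (n - 1) :: real vec)"
      then have i: "i < n - 1" by simp
      then have "xs ! Suc i \<in> L" using xsL assms(4) by auto
      with i iso that B \<open>\<And>k. k < n - 1 \<Longrightarrow> col ?B k = xs ! Suc k\<close>
      show "(?B\<^sup>T *\<^sub>v (?J *\<^sub>v x)) $ i = 0\<^sub>v (n - 1) $ i" by simp
    qed (use B in simp)
    \<comment> \<open>Transposing reverses the factors of \<open>M\<close>, so
      \<open>?B\<^sup>T\<close> acts directly on \<open>?J *\<^sub>v x\<close>.\<close>
    have "N *\<^sub>v x = ?J\<^sup>T *\<^sub>v ((pinv ?A)\<^sup>T *\<^sub>v (?B\<^sup>T *\<^sub>v (?J *\<^sub>v x)))"
      unfolding N_def M_def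
      by (simp only: transpose_mult[OF B P]
          assoc_mult_mat_vec[OF mult_carrier_mat[OF JT mult_carrier_mat[OF PT BT]] J x]
          assoc_mult_mat_vec[OF JT mult_carrier_mat[OF PT BT] Jx] assoc_mult_mat_vec[OF PT BT Jx])
    also have "\<dots> = 0\<^sub>v (2 * n)" by (simp only: 0 mult_mat_zero_vec[OF PT] mult_mat_zero_vec[OF JT])
    finally show ?thesis .
  qed
  have "(M + N) *\<^sub>v (xs ! k) = xs ! Suc k" if "k < n - 1" for k
  proof -
    have "xs ! k \<in> set xs" "xs ! Suc k \<in> set xs" using that assms(4) by auto
    then show ?thesis
      using that xs xsL M N Mx Nx
      by (auto simp: add_mult_distrib_mat_vec[of _ "2 * n" "2 * n"] subset_iff)
  qed
  then show ?thesis
    using skew_hamiltonian_symmetrization[OF M]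
    by (simp add: HK_def H_hat_def M_def N_def)
qed

end
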